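(* For all positive integers $m \leq n$, \[ |\mathrm{rSYT}(m,n)| \leq \frac{1}{m!\,n!} \sum_{i=0}^{m+n} \binom{2\binom{m}{2}\binom{n}{2} + \binom{m}{2} + \binom{n}{2}}{i} .\] In particular, $|\mathrm{rSYT}(n,n)| \leq n^{4n+o(n)}$ as $n\to\infty$.
   Context: For positive integers $m,n$, an $m\times n$ (rectangular) standard Young tableau is a bijection $T:[m]\times[n]\to\{1,\dots,mn\}$ that is increasing along rows and columns: $T(i,j)<T(i,j+1)$ and $T(i,j)<T(i+1,j)$ whenever defined. A vector $x\in\mathbb{R}^k$ is increasing if $x_1<x_2<\dots<x_k$. For increasing $x\in\mathbb{R}^m$, $y\in\mathbb{R}^n$ such that the $mn$ numbers $x_i+y_j$, $(i,j)\in[m]\times[n]$, are pairwise distinct, let $\mathcal T(x\circ y)$ be the tableau whose $(i,j)$ entry is the rank of $x_i+y_j$ among these $mn$ numbers (rank $1$ = smallest). An $m\times n$ standard Young tableau is realizable if it equals $\mathcal T(x\circ y)$ for some such $x,y$. $\mathrm{rSYT}(m,n)$ denotes the set of realizable $m\times n$ standard Young tableaux. *)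

theory Defs
  imports Complex_Main "HOL-Library.FuncSet" "HOL-Library.Landau_Symbols"
begin

definition cells :: "nat \<Rightarrow> nat \<Rightarrow> (nat \<times> nat) set" where
  "cells m n = {1..m} \<times> {1..n}"

text \<open>
  Tableaux are functions on all pairs of naturals that are \<^const>\<open>undefined\<close> outside the
  rectangle, so that they can be counted without spurious multiplicity.
\<close>

definition SYT :: "nat \<Rightarrow> nat \<Rightarrow> (nat \<times> nat \<Rightarrow> nat) set" where
  "SYT m n = {T \<in> extensional (cells m n).
     bij_betw T (cells m n) {1..m * n} \<and>
     (\<forall>i j. (i, j) \<in> cells m n \<and> (i, j + 1) \<in> cells m n \<longrightarrow> T (i, j) < T (i, j + 1)) \<and>
     (\<forall>i j. (i, j) \<in> cells m n \<and> (i + 1, j) \<in> cells m n \<longrightarrow> T (i, j) < T (i + 1, j))}"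

text \<open>
  A vector of length \<open>k\<close> is a function \<^typ>\<open>nat \<Rightarrow> real\<close> of which only the values on
  \<open>{1..k}\<close> matter.
\<close>

definition increasing_vec :: "nat \<Rightarrow> (nat \<Rightarrow> real) \<Rightarrow> bool" where
  "increasing_vec k x \<longleftrightarrow> strict_mono_on {1..k} x"

definition distinct_sums :: "nat \<Rightarrow> nat \<Rightarrow> (nat \<Rightarrow> real) \<Rightarrow> (nat \<Rightarrow> real) \<Rightarrow> bool" where
  "distinct_sums m n x y \<longleftrightarrow> inj_on (\<lambda>(i, j). x i + y j) (cells m n)"

definition rank_in :: "real set \<Rightarrow> real \<Rightarrow> nat" where
  "rank_in S a = card {s \<in> S. s \<le> a}"

definition sum_tableau ::
  "nat \<Rightarrow> nat \<Rightarrow> (nat \<Rightarrow> real) \<Rightarrow> (nat \<Rightarrow> real) \<Rightarrow> nat \<times> nat \<Rightarrow> nat" where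
  "sum_tableau m n x y =
     (\<lambda>(i, j)\<in>cells m n. rank_in ((\<lambda>(k, l). x k + y l) ` cells m n) (x i + y j))"

definition realizable :: "nat \<Rightarrow> nat \<Rightarrow> (nat \<times> nat \<Rightarrow> nat) \<Rightarrow> bool" where
  "realizable m n T \<longleftrightarrow>
     (\<exists>x y. increasing_vec m x \<and> increasing_vec n y \<and> distinct_sums m n x y \<and>
            T = sum_tableau m n x y)"

definition rSYT :: "nat \<Rightarrow> nat \<Rightarrow> (nat \<times> nat \<Rightarrow> nat) set" where
  "rSYT m n = {T \<in> SYT m n. realizable m n T}"

lemma finite_rSYT: "finite (rSYT m n)"
proof (rule finite_subset)
  show "rSYT m n \<subseteq> cells m n \<rightarrow>\<^sub>E {1..m * n}"
    by (auto simp: rSYT_def SYT_def PiE_def bij_betw_def)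
  show "finite (cells m n \<rightarrow>\<^sub>E {1..m * n})"
    by (intro finite_PiE) (auto simp: cells_def)
qed

end

theory Submission
  imports Defs "HOL-Combinatorics.Permutations"
begin

text \<open>
  For generic \<open>x \<in> \<real>\<^sup>m\<close>, \<open>y \<in> \<real>\<^sup>n\<close> consider the signs of all the linear forms
  \<open>x\<^sub>i - x\<^sub>j\<close>, \<open>y\<^sub>k - y\<^sub>l\<close> and \<open>(x\<^sub>i + y\<^sub>k) - (x\<^sub>j + y\<^sub>l)\<close> with \<open>i < j\<close>, \<open>k \<noteq> l\<close>.
  Permuting the coordinates of realizing vectors in all \<open>m! n!\<close> ways gives different sign
  patterns, and different tableaux give different patterns, so \<open>m! n! |rSYT(m,n)|\<close> is at most
  the number of sign patterns. If a set of forms is shattered by the sign patterns, it is linearly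
  independent: a relation with coefficients \<open>c\<close> is violated at a point at which every form
  has the sign of its coefficient. Hence shattered sets have at most \<open>m + n\<close> elements,
  and the bound is the Sauer--Shelah lemma.
\<close>

section \<open>The Sauer--Shelah lemma\<close>

definition shatters :: "'a set set \<Rightarrow> 'a set \<Rightarrow> bool" where
  "shatters F S \<longleftrightarrow> (\<forall>A\<subseteq>S. \<exists>B\<in>F. B \<inter> S = A)"

text \<open>Pajor's form of Sauer-Shelah, by induction on the ground set. Split \<open>F\<close> by
  the new element \<open>h\<close> into \<open>A\<close> (sets avoiding \<open>h\<close>) and
  \<open>C'\<close> (sets containing \<open>h\<close>, with \<open>h\<close> deleted), so that
  \<open>card F\<close> is the size of \<open>A \<union> C'\<close> plus that of
  \<open>A \<inter> C'\<close>. A set shattered by the union is shattered by \<open>F\<close>; a set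
  shattered by the intersection stays so after adding \<open>h\<close>. The two families of
  shattered sets differ in containing \<open>h\<close>, so no set is counted twice.\<close>

lemma card_le_card_shattered:
  assumes "finite H" "F \<subseteq> Pow H"
  shows "card F \<le> card {S. S \<subseteq> H \<and> shatters F S}"
  using assms
proof (induction H arbitrary: F rule: finite_induct)
  case empty
  then have "F = {} \<or> F = {{}}" by auto
  then show ?case
  proof
    assume F: "F = {{}}"
    have eq: "{S. S \<subseteq> {} \<and> shatters {{}} S} = {{}}" by (auto simp: shatters_def)
    show ?thesis unfolding F eq by simp
  qed simp
next
  case (insert h H)
  define A where "A = {B\<in>F. h \<notin> B}"
  define C where "C = {B\<in>F. h \<in> B}"
  define C' where "C' = (\<lambda>X. X - {h}) ` C"
  have finF: "finite F" using insert.prems insert.hyps by (meson finite_Pow_iff finite_insert finite_subset)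
  have fins: "finite A" "finite C" "finite C'" using finF by (auto simp: A_def C_def C'_def)
  have "card C' = card C"
    unfolding C'_def by (intro card_image) (auto simp: inj_on_def C_def)
  moreover have "card F = card A + card C"
  proof -
    have "F = A \<union> C" "A \<inter> C = {}" by (auto simp: A_def C_def)
    then show ?thesis using fins card_Un_disjoint by metis
  qed
  ultimately have cF: "card F = card (A \<union> C') + card (A \<inter> C')"
    using card_Un_Int[of A C'] fins by simp
  let ?SU = "{S. S \<subseteq> H \<and> shatters (A \<union> C') S}"
  let ?SI = "{S. S \<subseteq> H \<and> shatters (A \<inter> C') S}"
  let ?S = "{S. S \<subseteq> insert h H \<and> shatters F S}"
  have AH: "A \<subseteq> Pow H" "C' \<subseteq> Pow H"
    using insert.prems by (auto simp: A_def C'_def C_def)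
  have le0: "card (A \<union> C') \<le> card ?SU" "card (A \<inter> C') \<le> card ?SI"
    by (rule insert.IH; use AH in blast)+
  have finS: "finite ?S" "finite ?SU" "finite ?SI" using insert.hyps by auto
  have sub0: "?SU \<subseteq> ?S"
  proof clarsimp
    fix S assume S: "S \<subseteq> H" "shatters (A \<union> C') S"
    have "\<exists>B\<in>F. B \<inter> S = Q" if Q: "Q \<subseteq> S" for Q
    proof -
      obtain B where B: "B \<in> A \<union> C'" "B \<inter> S = Q" using S(2) Q unfolding shatters_def by blast
      show ?thesis
      proof (cases "B \<in> A")
        case True then show ?thesis using B by (auto simp: A_def)
      next
        case False
        \<comment> \<open>Restoring \<open>h\<close> does not change the trace on \<open>S\<close>,
          because \<open>h\<close> lies outside \<open>S\<close>.\<close>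
        then obtain D where "D \<in> F" "B = D - {h}" using B by (auto simp: C'_def C_def)
        then show ?thesis using B S(1) insert.hyps by (intro bexI[of _ D]) auto
      qed
    qed
    then show "S \<subseteq> insert h H \<and> shatters F S" using S by (auto simp: shatters_def)
  qed
  have sub1: "insert h ` ?SI \<subseteq> ?S"
  proof clarsimp
    fix S assume S: "S \<subseteq> H" "shatters (A \<inter> C') S"
    have hS: "h \<notin> S" using S(1) insert.hyps by auto
    have "\<exists>B\<in>F. B \<inter> insert h S = Q" if Q: "Q \<subseteq> insert h S" for Q
    proof -
      have "Q - {h} \<subseteq> S" using Q by auto
      then obtain B where B: "B \<in> A" "B \<in> C'" "B \<inter> S = Q - {h}"
        using S(2) unfolding shatters_def by blast
      show ?thesis
      \<comment> \<open>Membership of \<open>B\<close> in both families means that \<open>B\<close>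
        and \<open>insert h B\<close> both lie in \<open>F\<close>; the one that agrees with
        \<open>Q\<close> at \<open>h\<close> is taken.\<close>
      proof (cases "h \<in> Q")
        case True
        obtain D where "D \<in> F" "h \<in> D" "B = D - {h}" using B by (auto simp: C'_def C_def)
        then show ?thesis using B hS True Q by (intro bexI[of _ D]) auto
      next
        case False
        then show ?thesis using B by (intro bexI[of _ B]) (auto simp: A_def)
      qed
    qed
    then show "S \<subseteq> insert h H \<and> shatters F (insert h S)" using S by (auto simp: shatters_def)
  qed
  have "inj_on (insert h) ?SI"
    using insert.hyps by (intro inj_onI) (metis (mono_tags, lifting) insert_ident mem_Collect_eq subsetD)
  then have "card (insert h ` ?SI) = card ?SI" by (rule card_image)
  moreover have "?SU \<inter> insert h ` ?SI = {}" using insert.hyps by auto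
  ultimately have "card ?SU + card ?SI = card (?SU \<union> insert h ` ?SI)"
    using finS by (subst card_Un_disjoint) auto
  also have "\<dots> \<le> card ?S" using sub0 sub1 finS by (intro card_mono) auto
  finally show ?case using cF le0 by linarith
qed

lemma card_subsets_card_le:
  assumes "finite H"
  shows "card {S. S \<subseteq> H \<and> card S \<le> d} = (\<Sum>i=0..d. card H choose i)"
proof -
  have "{S. S \<subseteq> H \<and> card S \<le> d} = (\<Union>i\<in>{0..d}. {S. S \<subseteq> H \<and> card S = i})" by auto
  also have "card \<dots> = (\<Sum>i\<in>{0..d}. card {S. S \<subseteq> H \<and> card S = i})"
    using assms by (intro card_UN_disjoint) auto
  finally show ?thesis using assms by (simp add: n_subsets)
qed

section \<open>Sign patterns of linear forms\<close>

text \<open>Gaussian elimination: a pivot row \<open>t\<close> with \<open>a t k \<noteq> 0\<close>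
  clears coordinate \<open>k\<close> from the other rows, and rows and coordinates both drop by one.
  Rows are indexed by \<open>S\<close>, so two equal rows count as dependent.\<close>

lemma nontrivial_linear_relation:
  fixes a :: "'s \<Rightarrow> 'k \<Rightarrow> real"
  assumes "finite K" "finite S" "card K < card S"
  shows "\<exists>c. (\<exists>s\<in>S. c s \<noteq> 0) \<and> (\<forall>k\<in>K. (\<Sum>s\<in>S. c s * a s k) = 0)"
  using assms
proof (induction K arbitrary: S a rule: finite_induct)
  case empty
  then have "S \<noteq> {}" by auto
  then show ?case by (intro exI[of _ "\<lambda>_. 1"]) auto
next
  case (insert k K)
  show ?case
  proof (cases "\<forall>s\<in>S. a s k = 0")
    case True
    have "card K < card S" using insert.prems insert.hyps by simp
    then show ?thesis using insert.IH[of S a] insert.prems True by auto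
  next
    case False
    then obtain t where t: "t \<in> S" "a t k \<noteq> 0" by auto
    define S' where "S' = S - {t}"
    have S': "finite S'" "t \<notin> S'" "S = insert t S'" using t insert.prems by (auto simp: S'_def)
    then have "card K < card S'" using insert.prems insert.hyps by simp
    then obtain c where c: "\<exists>s\<in>S'. c s \<noteq> 0"
      "\<forall>j\<in>K. (\<Sum>s\<in>S'. c s * (a s j - a s k / a t k * a t j)) = 0"
      using insert.IH[of S' "\<lambda>s j. a s j - a s k / a t k * a t j"] S' by auto
    \<comment> \<open>The value at \<open>t\<close> collects the multiples of row \<open>t\<close>
      subtracted during the elimination.\<close>
    define c' where "c' = c(t := - (\<Sum>s\<in>S'. c s * a s k) / a t k)"
    have c'_eq: "c' s = c s" if "s \<in> S'" for s using that S' by (auto simp: c'_def)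
    have "(\<Sum>s\<in>S. c' s * a s j) = (\<Sum>s\<in>S'. c s * (a s j - a s k / a t k * a t j))" for j
    proof -
      have "(\<Sum>s\<in>S. c' s * a s j) = c' t * a t j + (\<Sum>s\<in>S'. c s * a s j)"
        using S' c'_eq by simp
      moreover have "c' t * a t j = - (\<Sum>s\<in>S'. c s * (a s k / a t k * a t j))"
        by (simp add: c'_def sum_distrib_left sum_divide_distrib algebra_simps)
      ultimately show ?thesis by (simp add: right_diff_distrib sum_subtractf)
    qed
    moreover have "(\<Sum>s\<in>S'. c s * (a s k - a s k / a t k * a t k)) = 0" using t by simp
    ultimately have "\<forall>j\<in>insert k K. (\<Sum>s\<in>S. c' s * a s j) = 0" using c(2) by auto
    moreover have "\<exists>s\<in>S. c' s \<noteq> 0" using c(1) c'_eq S'(3) by auto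
    ultimately show ?thesis by blast
  qed
qed

text \<open>One set for each region of the central hyperplane arrangement given by the forms: the
  forms positive on that region. Since \<open>z\<close> avoids all hyperplanes, absence from the set
  means a negative value.\<close>

definition sign_patterns :: "('h \<Rightarrow> 'k \<Rightarrow> real) \<Rightarrow> 'h set \<Rightarrow> 'k set \<Rightarrow> 'h set set" where
  "sign_patterns a H K =
     {{h\<in>H. 0 < (\<Sum>k\<in>K. a h k * z k)} | z. \<forall>h\<in>H. (\<Sum>k\<in>K. a h k * z k) \<noteq> 0}"

lemma card_shattered_by_sign_patterns:
  assumes "finite H" "finite K" "S \<subseteq> H" "shatters (sign_patterns a H K) S"
  shows "card S \<le> card K"
proof (rule ccontr)
  assume "\<not> card S \<le> card K"
  moreover have finS: "finite S" using assms finite_subset by blast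
  ultimately obtain c where c: "\<exists>s\<in>S. c s \<noteq> 0" "\<forall>k\<in>K. (\<Sum>s\<in>S. c s * a s k) = 0"
    using nontrivial_linear_relation[of K S a] assms by auto
  \<comment> \<open>Shattering yields a point where, within \<open>S\<close>, the forms with
    positive coefficient are positive and all others negative. Each product \<open>c s * L s\<close>
    is then nonnegative, and a vanishing sum forces every \<open>c s\<close> to be zero.\<close>
  obtain B where B: "B \<in> sign_patterns a H K" "B \<inter> S = {s\<in>S. c s > 0}"
    using assms(4) unfolding shatters_def by (metis (no_types, lifting) mem_Collect_eq subsetI)
  then obtain z where z: "\<forall>h\<in>H. (\<Sum>k\<in>K. a h k * z k) \<noteq> 0"
      "B = {h\<in>H. 0 < (\<Sum>k\<in>K. a h k * z k)}"
    by (auto simp: sign_patterns_def)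
  define L where "L h = (\<Sum>k\<in>K. a h k * z k)" for h
  have sgn: "L s \<noteq> 0" "0 < L s \<longleftrightarrow> 0 < c s" if "s \<in> S" for s
    using that z B(2) assms(3) unfolding L_def by auto
  have "(\<Sum>s\<in>S. c s * L s) = (\<Sum>s\<in>S. \<Sum>k\<in>K. c s * a s k * z k)"
    by (simp add: L_def sum_distrib_left mult.assoc)
  also have "\<dots> = (\<Sum>k\<in>K. (\<Sum>s\<in>S. c s * a s k) * z k)"
    by (subst sum.swap) (simp add: sum_distrib_right)
  also have "\<dots> = 0" using c(2) by simp
  finally have "(\<Sum>s\<in>S. c s * L s) = 0" .
  moreover have nonneg: "0 \<le> c s * L s" if "s \<in> S" for s
    using sgn[OF that] by (cases "0 < c s") (auto intro: mult_nonpos_nonpos)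
  ultimately have "\<forall>s\<in>S. c s * L s = 0" using finS by (simp add: sum_nonneg_eq_0_iff)
  then show False using c(1) sgn(1) by auto
qed

lemma card_sign_patterns_le:
  assumes "finite H" "finite K"
  shows "card (sign_patterns a H K) \<le> (\<Sum>i=0..card K. card H choose i)"
proof -
  have "card (sign_patterns a H K) \<le> card {S. S \<subseteq> H \<and> shatters (sign_patterns a H K) S}"
    using assms by (intro card_le_card_shattered) (auto simp: sign_patterns_def)
  also have "\<dots> \<le> card {S. S \<subseteq> H \<and> card S \<le> card K}"
    using assms card_shattered_by_sign_patterns[OF assms] by (intro card_mono) auto
  finally show ?thesis using card_subsets_card_le[OF assms(1)] by simp
qed

section \<open>Tableaux and their sign patterns\<close>

text \<open>A bijection onto \<open>{1..N}\<close> is a ranking: each value is one more than the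
  number of elements with smaller value, so the order alone determines it.\<close>

lemma bij_betw_same_order_eq:
  fixes f g :: "'a \<Rightarrow> nat"
  assumes f: "bij_betw f A {1..N}" and g: "bij_betw g A {1..N}"
    and ord: "\<And>a b. a \<in> A \<Longrightarrow> b \<in> A \<Longrightarrow> f a < f b \<longleftrightarrow> g a < g b"
    and a: "a \<in> A"
  shows "f a = g a"
proof -
  have rank: "card {b\<in>A. h b < h a} = h a - 1" if h: "bij_betw h A {1..N}" for h
  proof -
    have "h ` {b\<in>A. h b < h a} = {1..<h a}"
    proof
      show "{1..<h a} \<subseteq> h ` {b\<in>A. h b < h a}"
      proof
        fix v assume v: "v \<in> {1..<h a}"
        have "h a \<in> {1..N}" using h a by (auto simp: bij_betw_def)
        then have "v \<in> h ` A" using v h by (auto simp: bij_betw_def)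
        then show "v \<in> h ` {b\<in>A. h b < h a}" using v by auto
      qed
      have "\<And>b. b \<in> A \<Longrightarrow> h b \<in> {1..N}" using h by (auto simp: bij_betw_def)
      then show "h ` {b\<in>A. h b < h a} \<subseteq> {1..<h a}" by auto
    qed
    moreover have "inj_on h {b\<in>A. h b < h a}"
      using h by (auto simp: bij_betw_def intro: inj_on_subset)
    ultimately show ?thesis by (metis card_image card_atLeastLessThan)
  qed
  have "{b\<in>A. f b < f a} = {b\<in>A. g b < g a}" using ord a by auto
  then have "f a - 1 = g a - 1" using rank[OF f] rank[OF g] by simp
  \<comment> \<open>The subtraction on naturals is truncated, so these lower bounds are what turns
    the previous equality into \<open>f a = g a\<close>.\<close>
  moreover have "f a \<ge> 1" "g a \<ge> 1" using f g a by (auto simp: bij_betw_def)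
  ultimately show ?thesis by linarith
qed

lemma rank_in_less_iff:
  assumes "finite S" "a \<in> S" "b \<in> S"
  shows "rank_in S a < rank_in S b \<longleftrightarrow> a < b"
proof -
  have "rank_in S a < rank_in S b" if "a < b" "b \<in> S" for a b
  proof -
    have "b \<in> {s \<in> S. s \<le> b}" "b \<notin> {s \<in> S. s \<le> a}" using that by auto
    moreover have "{s \<in> S. s \<le> a} \<subseteq> {s \<in> S. s \<le> b}" using that by auto
    ultimately show ?thesis
      unfolding rank_in_def using assms(1) by (intro psubset_card_mono) auto
  qed
  moreover have "rank_in S b \<le> rank_in S a" if "b \<le> a"
    unfolding rank_in_def using that assms(1) by (intro card_mono) auto
  ultimately show ?thesis using assms by (metis linorder_not_le)
qed

lemma sum_tableau_less_iff:
  assumes "(i, k) \<in> cells m n" "(j, l) \<in> cells m n"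
  shows "sum_tableau m n x y (i, k) < sum_tableau m n x y (j, l) \<longleftrightarrow> x i + y k < x j + y l"
proof -
  have "finite ((\<lambda>(k, l). x k + y l) ` cells m n)" by (simp add: cells_def)
  then show ?thesis using assms unfolding sum_tableau_def
    by (simp add: rank_in_less_iff image_iff) (subst rank_in_less_iff; force)
qed

section \<open>The linear forms and their number\<close>

text \<open>
  The pair \<open>((i, k), (j, l))\<close> stands for the form \<open>(x\<^sub>i + y\<^sub>k) - (x\<^sub>j + y\<^sub>l)\<close>;
  the forms \<open>x\<^sub>i - x\<^sub>j\<close> and \<open>y\<^sub>k - y\<^sub>l\<close> are represented with the dummy indices
  \<open>k = l = 1\<close> and \<open>i = j = 1\<close>.
\<close>

definition form_indices :: "nat \<Rightarrow> nat \<Rightarrow> ((nat \<times> nat) \<times> nat \<times> nat) set" where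
  "form_indices m n =
     {((i, k), (j, l)) | i j k l. i \<in> {1..m} \<and> j \<in> {1..m} \<and> k \<in> {1..n} \<and> l \<in> {1..n} \<and>
        (i < j \<and> k = 1 \<and> l = 1 \<or> i = 1 \<and> j = 1 \<and> k < l \<or> i < j \<and> k \<noteq> l)}"

text \<open>Coordinate \<open>Inl i\<close> is \<open>x i\<close> and \<open>Inr k\<close> is
  \<open>y k\<close>. Because indicators are added and subtracted, the equal dummy indices cancel
  and leave a pure difference.\<close>

definition form_coeff :: "(nat \<times> nat) \<times> nat \<times> nat \<Rightarrow> nat + nat \<Rightarrow> real" where
  "form_coeff = (\<lambda>((i, k), (j, l)) p.
     of_bool (p = Inl i) + of_bool (p = Inr k) - of_bool (p = Inl j) - of_bool (p = Inr l))"

lemma form_coeff_sum: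
  assumes "(i, k) \<in> cells m n" "(j, l) \<in> cells m n"
  shows "(\<Sum>p\<in>{1..m} <+> {1..n}. form_coeff ((i, k), (j, l)) p * case_sum x y p)
         = x i + y k - (x j + y l)"
  using assms
  by (simp add: form_coeff_def cells_def InlI InrI sum_subtractf sum.distrib algebra_simps
      of_bool_def if_distrib[of "\<lambda>c. _ * c"] sum.delta cong: if_cong)

lemma card_increasing_pairs:
  "card {(i, j). i \<in> {1..m} \<and> j \<in> {1..m} \<and> i < (j::nat)} = m choose 2"
proof (induction m)
  case (Suc m)
  let ?P = "\<lambda>m. {(i, j). i \<in> {1..m} \<and> j \<in> {1..m} \<and> i < (j::nat)}"
  have "finite (?P m)" by (rule finite_subset[of _ "{1..m} \<times> {1..m}"]) auto
  moreover have "?P m \<inter> {1..m} \<times> {Suc m} = {}" by auto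
  ultimately have "card (?P m \<union> {1..m} \<times> {Suc m}) = card (?P m) + m"
    by (simp add: card_Un_disjoint)
  moreover have "?P (Suc m) = ?P m \<union> {1..m} \<times> {Suc m}" by auto
  ultimately have "card (?P (Suc m)) = card (?P m) + m" by (simp only:)
  then show ?case using Suc by (simp add: numeral_2_eq_2)
qed auto

text \<open>Mixed forms come from a pair \<open>i < j\<close> and an ordered pair
  \<open>k \<noteq> l\<close>, which gives the factor 2; those with \<open>i > j\<close> would only
  repeat them up to sign. Positivity of \<open>m\<close> and \<open>n\<close> puts the dummy index 1
  in range.\<close>

lemma card_form_indices:
  assumes "0 < m" "0 < n"
  shows "finite (form_indices m n)"
    and "card (form_indices m n) = 2 * (m choose 2) * (n choose 2) + (m choose 2) + (n choose 2)"
proof -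
  let ?P = "\<lambda>m. {(i, j). i \<in> {1..m} \<and> j \<in> {1..m} \<and> i < (j::nat)}"
  have finP: "finite (?P m)" for m by (rule finite_subset[of _ "{1..m} \<times> {1..m}"]) auto
  let ?e = "\<lambda>((i::nat, j::nat), (k::nat, l::nat)). ((i, k), (j, l))"
  have inj: "inj_on ?e X" for X by (auto simp: inj_on_def)
  define Q where "Q = ?P n \<union> prod.swap ` ?P n"
  have finQ: "finite Q" using finP by (simp add: Q_def)
  have "card (prod.swap ` ?P n) = n choose 2"
    by (subst card_image) (use card_increasing_pairs in auto)
  moreover have "?P n \<inter> prod.swap ` ?P n = {}" by auto
  ultimately have cQ: "card Q = 2 * (n choose 2)"
    unfolding Q_def using finP card_increasing_pairs[of n] by (subst card_Un_disjoint) auto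
  have Q_iff: "(k, l) \<in> Q \<longleftrightarrow> k \<in> {1..n} \<and> l \<in> {1..n} \<and> k \<noteq> l" for k l
    by (auto simp: Q_def image_iff)
  \<comment> \<open>Regrouped as row pair and column pair, the indices form three disjoint products:
    pure row, pure column and mixed forms.\<close>
  define X where "X = ?P m \<times> {(1::nat, 1::nat)} \<union> {(1::nat, 1::nat)} \<times> ?P n \<union> ?P m \<times> Q"
  have img: "form_indices m n = ?e ` X"
  proof (intro set_eqI)
    fix w :: "(nat \<times> nat) \<times> nat \<times> nat"
    obtain i k j l where w: "w = ((i, k), (j, l))" by (metis surj_pair)
    have "w \<in> ?e ` X \<longleftrightarrow> ((i, j), (k, l)) \<in> X" unfolding w by (force simp: image_iff)
    also have "\<dots> \<longleftrightarrow> w \<in> form_indices m n"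
      using assms by (auto simp: w X_def form_indices_def Q_iff)
    finally show "w \<in> form_indices m n \<longleftrightarrow> w \<in> ?e ` X" by simp
  qed
  have finX: "finite X" using finP finQ by (auto simp: X_def)
  then show "finite (form_indices m n)" using img by simp
  have "card X = card (?P m) + card (?P n) + card (?P m) * card Q"
    unfolding X_def
    by (subst card_Un_disjoint, use finP finQ Q_iff in \<open>auto simp: card_cartesian_product\<close>,
        subst card_Un_disjoint, auto simp: card_cartesian_product)
  then show "card (form_indices m n) = 2 * (m choose 2) * (n choose 2) + (m choose 2) + (n choose 2)"
    using img card_image[OF inj] cQ card_increasing_pairs by simp
qed

section \<open>Sign patterns of realizing vectors\<close>

definition sum_pattern ::
  "nat \<Rightarrow> nat \<Rightarrow> (nat \<Rightarrow> real) \<Rightarrow> (nat \<Rightarrow> real) \<Rightarrow> ((nat \<times> nat) \<times> nat \<times> nat) set" where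
  "sum_pattern m n x y = {((i, k), (j, l)) \<in> form_indices m n. x j + y l < x i + y k}"

text \<open>The witnessing point is \<open>case_sum x y\<close>. The two cells of a form index
  always differ, so distinctness of the sums says that no form vanishes there.\<close>

lemma sum_pattern_in_sign_patterns:
  assumes "distinct_sums m n x y"
  shows "sum_pattern m n x y \<in> sign_patterns form_coeff (form_indices m n) ({1..m} <+> {1..n})"
proof -
  let ?L = "\<lambda>h. \<Sum>p\<in>{1..m} <+> {1..n}. form_coeff h p * case_sum x y p"
  have L: "?L ((i, k), (j, l)) = x i + y k - (x j + y l)"
    if "((i, k), (j, l)) \<in> form_indices m n" for i j k l
    using that by (intro form_coeff_sum) (auto simp: form_indices_def cells_def)
  have "?L h \<noteq> 0" if h: "h \<in> form_indices m n" for h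
  proof -
    obtain i k j l where hh: "h = ((i, k), (j, l))" by (metis surj_pair)
    have "(i, k) \<in> cells m n" "(j, l) \<in> cells m n" "(i, k) \<noteq> (j, l)"
      using h by (auto simp: hh form_indices_def cells_def)
    then have "x i + y k \<noteq> x j + y l"
      using assms unfolding distinct_sums_def inj_on_def by fastforce
    then show ?thesis using L h hh by auto
  qed
  moreover have "sum_pattern m n x y = {h \<in> form_indices m n. 0 < ?L h}"
    using L by (auto simp: sum_pattern_def)
  ultimately show ?thesis unfolding sign_patterns_def by blast
qed

text \<open>Up to sign, each comparison of sums at distinct cells is governed by one of the forms:
  in a common row or column the shared summand cancels and is replaced by the one at index 1, and
  when the indices are in the wrong order the roles of the cells are exchanged. Distinctness turns
  "not greater" into "less".\<close>

lemma sum_pattern_determines_order: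
  assumes eq: "sum_pattern m n x y = sum_pattern m n x' y'"
    and dist: "distinct_sums m n x y" "distinct_sums m n x' y'"
    and c: "(i, k) \<in> cells m n" "(j, l) \<in> cells m n"
  shows "x i + y k < x j + y l \<longleftrightarrow> x' i + y' k < x' j + y' l"
proof -
  have key: "x i + y k < x j + y l \<longleftrightarrow> x' i + y' k < x' j + y' l"
    "x j + y l < x i + y k \<longleftrightarrow> x' j + y' l < x' i + y' k"
    if h: "((i, k), (j, l)) \<in> form_indices m n" for i j k l
  proof -
    have "((i, k), (j, l)) \<in> sum_pattern m n x y \<longleftrightarrow> ((i, k), (j, l)) \<in> sum_pattern m n x' y'"
      using eq by simp
    then show *: "x j + y l < x i + y k \<longleftrightarrow> x' j + y' l < x' i + y' k"
      using h by (simp add: sum_pattern_def)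
    have "(i, k) \<in> cells m n" "(j, l) \<in> cells m n" "(i, k) \<noteq> (j, l)"
      using h by (auto simp: form_indices_def cells_def)
    then have "x i + y k \<noteq> x j + y l" "x' i + y' k \<noteq> x' j + y' l"
      using dist unfolding distinct_sums_def inj_on_def by fastforce+
    then show "x i + y k < x j + y l \<longleftrightarrow> x' i + y' k < x' j + y' l"
      using * by linarith
  qed
  have range: "i \<in> {1..m}" "j \<in> {1..m}" "k \<in> {1..n}" "l \<in> {1..n}" "1 \<in> {1..m}" "1 \<in> {1..n}"
    using c by (auto simp: cells_def)
  consider "i = j" "k = l" | "i = j" "k < l" | "i = j" "l < k" | "i < j" "k = l" | "j < i" "k = l"
    | "i < j" "k \<noteq> l" | "j < i" "k \<noteq> l" by linarith
  then show ?thesis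
  proof cases
    case 2 then show ?thesis using key[of 1 k 1 l] range by (auto simp: form_indices_def)
  next
    case 3 then show ?thesis using key[of 1 l 1 k] range by (auto simp: form_indices_def)
  next
    case 4 then show ?thesis using key[of i 1 j 1] range by (auto simp: form_indices_def)
  next
    case 5 then show ?thesis using key[of j 1 i 1] range by (auto simp: form_indices_def)
  next
    case 6 then show ?thesis using key(1)[of i k j l] range by (auto simp: form_indices_def)
  next
    case 7 then show ?thesis using key(2)[of j l i k] range by (auto simp: form_indices_def)
  qed simp
qed

section \<open>Permuted realizations and the count\<close>

lemma distinct_sums_permute:
  assumes "distinct_sums m n x y" "\<sigma> permutes {1..m}" "\<tau> permutes {1..n}"
  shows "distinct_sums m n (x \<circ> \<sigma>) (y \<circ> \<tau>)"
  unfolding distinct_sums_def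
proof (rule inj_onI, clarify)
  fix i k j l
  assume c: "(i, k) \<in> cells m n" "(j, l) \<in> cells m n"
    and "(x \<circ> \<sigma>) i + (y \<circ> \<tau>) k = (x \<circ> \<sigma>) j + (y \<circ> \<tau>) l"
  moreover have "(\<sigma> i, \<tau> k) \<in> cells m n" "(\<sigma> j, \<tau> l) \<in> cells m n"
    using c permutes_in_image[OF assms(2)] permutes_in_image[OF assms(3)]
    unfolding cells_def mem_Times_iff fst_conv snd_conv by blast+
  ultimately have "(\<sigma> i, \<tau> k) = (\<sigma> j, \<tau> l)"
    using assms(1) unfolding distinct_sums_def inj_on_def by fastforce
  then show "i = j \<and> k = l"
    using permutes_inj[OF assms(2)] permutes_inj[OF assms(3)] by (auto dest: injD)
qed

lemma permutes_same_order_eq: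
  fixes \<sigma> \<sigma>' :: "nat \<Rightarrow> nat"
  assumes "\<sigma> permutes {1..m}" "\<sigma>' permutes {1..m}"
    and "\<And>i j. i \<in> {1..m} \<Longrightarrow> j \<in> {1..m} \<Longrightarrow> \<sigma> i < \<sigma> j \<longleftrightarrow> \<sigma>' i < \<sigma>' j"
  shows "\<sigma> = \<sigma>'"
proof
  fix i
  show "\<sigma> i = \<sigma>' i"
  proof (cases "i \<in> {1..m}")
    case True
    then show ?thesis
      using bij_betw_same_order_eq[of \<sigma> "{1..m}" m \<sigma>'] assms permutes_imp_bij by metis
  next
    case False
    then show ?thesis using assms(1,2) by (simp add: permutes_not_in)
  qed
qed

text \<open>Comparing sums within the first column gives the order of the values of the row
  permutation, since \<open>x\<close> is increasing; the first row does the same for the column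
  permutation. Once both permutations are known they can be undone, and the pattern then gives the
  order of all sums, hence the tableau. The realizing vectors themselves may differ.\<close>

lemma permuted_pattern_inj:
  assumes mn: "0 < m" "0 < n"
    and T: "sum_tableau m n x y \<in> SYT m n" and T': "sum_tableau m n x' y' \<in> SYT m n"
    and inc: "increasing_vec m x" "increasing_vec n y" "increasing_vec m x'" "increasing_vec n y'"
    and dist: "distinct_sums m n x y" "distinct_sums m n x' y'"
    and perm: "\<sigma> permutes {1..m}" "\<tau> permutes {1..n}" "\<sigma>' permutes {1..m}" "\<tau>' permutes {1..n}"
    and eq: "sum_pattern m n (x \<circ> \<sigma>) (y \<circ> \<tau>) = sum_pattern m n (x' \<circ> \<sigma>') (y' \<circ> \<tau>')"
  shows "sum_tableau m n x y = sum_tableau m n x' y' \<and> \<sigma> = \<sigma>' \<and> \<tau> = \<tau>'"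
proof -
  have ord: "x (\<sigma> i) + y (\<tau> k) < x (\<sigma> j) + y (\<tau> l) \<longleftrightarrow>
      x' (\<sigma>' i) + y' (\<tau>' k) < x' (\<sigma>' j) + y' (\<tau>' l)"
    if "i \<in> {1..m}" "j \<in> {1..m}" "k \<in> {1..n}" "l \<in> {1..n}" for i j k l
    using sum_pattern_determines_order[OF eq, of i k j l] that dist perm
    by (simp add: distinct_sums_permute cells_def)
  have mono: "z (\<rho> i) < z (\<rho> j) \<longleftrightarrow> \<rho> i < \<rho> j"
    if "increasing_vec N z" "\<rho> permutes {1..N}" "i \<in> {1..N}" "j \<in> {1..N}" for z \<rho> N i j
    using that permutes_in_image[OF that(2)] unfolding increasing_vec_def
    by (simp add: strict_mono_on_less del: atLeastAtMost_iff)
  have one: "1 \<in> {1..m}" "1 \<in> {1..n}" using mn by auto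
  have \<sigma>: "\<sigma> = \<sigma>'"
  proof (rule permutes_same_order_eq[OF perm(1,3)])
    fix i j assume "i \<in> {1..m}" "j \<in> {1..m}"
    then show "\<sigma> i < \<sigma> j \<longleftrightarrow> \<sigma>' i < \<sigma>' j"
      using ord[of i j 1 1] one mono inc perm by simp
  qed
  have \<tau>: "\<tau> = \<tau>'"
  proof (rule permutes_same_order_eq[OF perm(2,4)])
    fix i j assume "i \<in> {1..n}" "j \<in> {1..n}"
    then show "\<tau> i < \<tau> j \<longleftrightarrow> \<tau>' i < \<tau>' j"
      using ord[of 1 1 i j] one mono inc perm by simp
  qed
  have "sum_tableau m n x y p = sum_tableau m n x' y' p" if p: "p \<in> cells m n" for p
  proof (rule bij_betw_same_order_eq[OF _ _ _ p])
    show "bij_betw (sum_tableau m n x y) (cells m n) {1..m * n}"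
      "bij_betw (sum_tableau m n x' y') (cells m n) {1..m * n}"
      using T T' by (auto simp: SYT_def)
    fix p q assume pq: "p \<in> cells m n" "q \<in> cells m n"
    \<comment> \<open>Surjectivity of the permutations pulls arbitrary cells back to indices at
      which \<open>ord\<close> applies.\<close>
    obtain i k j l where [simp]: "p = (\<sigma> i, \<tau> k)" "q = (\<sigma> j, \<tau> l)"
      using permutes_surj[OF perm(1)] permutes_surj[OF perm(2)] by (metis surj_pair surjD)
    have "i \<in> {1..m}" "j \<in> {1..m}" "k \<in> {1..n}" "l \<in> {1..n}"
      using pq permutes_in_image[OF perm(1)] permutes_in_image[OF perm(2)]
      by (simp_all add: cells_def del: atLeastAtMost_iff)
    from ord[OF this]
    show "sum_tableau m n x y p < sum_tableau m n x y q \<longleftrightarrow>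
        sum_tableau m n x' y' p < sum_tableau m n x' y' q"
      using pq \<sigma> \<tau> by (simp add: sum_tableau_less_iff)
  qed
  then have "sum_tableau m n x y = sum_tableau m n x' y'"
    using T T' by (intro extensionalityI[of _ "cells m n"]) (auto simp: SYT_def)
  then show ?thesis using \<sigma> \<tau> by simp
qed

lemma fact_mult_card_rSYT_le:
  assumes "0 < m" "0 < n"
  shows "card (rSYT m n) * (fact m * fact n) \<le>
    (\<Sum>i = 0..m + n. (2 * (m choose 2) * (n choose 2) + (m choose 2) + (n choose 2)) choose i)"
proof -
  have "\<forall>T\<in>rSYT m n. \<exists>x y. increasing_vec m x \<and> increasing_vec n y \<and> distinct_sums m n x y \<and>
      T = sum_tableau m n x y"
    by (auto simp: rSYT_def realizable_def)
  \<comment> \<open>One realization per tableau is fixed, so a tableau with two permutations yields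
    a single pattern.\<close>
  then obtain X Y where XY: "\<And>T. T \<in> rSYT m n \<Longrightarrow> increasing_vec m (X T) \<and> increasing_vec n (Y T) \<and>
      distinct_sums m n (X T) (Y T) \<and> T = sum_tableau m n (X T) (Y T)"
    by metis
  let ?D = "rSYT m n \<times> {\<sigma>. \<sigma> permutes {1..m}} \<times> {\<tau>. \<tau> permutes {1..n}}"
  let ?pat = "\<lambda>(T, \<sigma>, \<tau>). sum_pattern m n (X T \<circ> \<sigma>) (Y T \<circ> \<tau>)"
  let ?F = "sign_patterns form_coeff (form_indices m n) ({1..m} <+> {1..n})"
  have finF: "finite ?F"
    by (rule finite_subset[of _ "Pow (form_indices m n)"])
      (use card_form_indices[OF assms] in \<open>auto simp: sign_patterns_def\<close>)
  have "inj_on ?pat ?D"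
  proof (rule inj_onI)
    fix u v assume uv: "u \<in> ?D" "v \<in> ?D" "?pat u = ?pat v"
    obtain T \<sigma> \<tau> T' \<sigma>' \<tau>' where u: "u = (T, \<sigma>, \<tau>)" and v: "v = (T', \<sigma>', \<tau>')"
      by (metis surj_pair)
    have T: "T \<in> rSYT m n" "T' \<in> rSYT m n"
      and p: "\<sigma> permutes {1..m}" "\<tau> permutes {1..n}" "\<sigma>' permutes {1..m}" "\<tau>' permutes {1..n}"
      using uv(1,2) by (auto simp: u v)
    have eq: "sum_pattern m n (X T \<circ> \<sigma>) (Y T \<circ> \<tau>) = sum_pattern m n (X T' \<circ> \<sigma>') (Y T' \<circ> \<tau>')"
      using uv(3) by (simp add: u v)
    have "sum_tableau m n (X T) (Y T) \<in> SYT m n" "sum_tableau m n (X T') (Y T') \<in> SYT m n"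
      using XY T by (auto simp: rSYT_def)
    from permuted_pattern_inj[OF assms this _ _ _ _ _ _ p eq] XY T
    show "u = v" unfolding u v by metis
  qed
  moreover have "?pat ` ?D \<subseteq> ?F"
  proof (rule image_subsetI, clarsimp simp del: One_nat_def)
    fix T \<sigma> \<tau> assume "T \<in> rSYT m n" "\<sigma> permutes {1..m}" "\<tau> permutes {1..n}"
    then show "sum_pattern m n (X T \<circ> \<sigma>) (Y T \<circ> \<tau>) \<in> ?F"
      using XY by (intro sum_pattern_in_sign_patterns distinct_sums_permute) auto
  qed
  ultimately have "card ?D \<le> card ?F" using finF by (rule card_inj_on_le)
  also have "card ?D = card (rSYT m n) * (fact m * fact n)"
    by (simp add: card_cartesian_product card_permutations)
  also have "card ?F \<le> (\<Sum>i = 0..card ({1..m} <+> {1..n}). card (form_indices m n) choose i)"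
    using card_form_indices[OF assms] by (intro card_sign_patterns_le) auto
  finally show ?thesis using card_form_indices[OF assms] by (simp add: card_Plus)
qed

lemma card_rSYT_le:
  assumes "0 < m" "0 < n"
  shows "real (card (rSYT m n)) \<le> 1 / (fact m * fact n) *
    (\<Sum>i = 0..m + n.
       real ((2 * (m choose 2) * (n choose 2) + (m choose 2) + (n choose 2)) choose i))"
proof -
  have "real (card (rSYT m n) * (fact m * fact n)) \<le>
    real (\<Sum>i = 0..m + n. (2 * (m choose 2) * (n choose 2) + (m choose 2) + (n choose 2)) choose i)"
    by (rule of_nat_mono[OF fact_mult_card_rSYT_le[OF assms]])
  then show ?thesis by (simp add: field_simps)
qed

section \<open>Asymptotics\<close>

text \<open>Chernoff's trick: for \<open>0 < t \<le> 1\<close> each term grows when multiplied by \<open>t\<^sup>i / t\<^sup>d\<close>.\<close>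

lemma sum_binomial_le_exp:
  fixes t :: real
  assumes "0 < t" "t \<le> 1"
  shows "(\<Sum>i=0..d. real (N choose i)) \<le> exp (t * real N) / t ^ d"
proof -
  have "(\<Sum>i=0..d. real (N choose i)) * t ^ d \<le> (\<Sum>i=0..d. real (N choose i) * t ^ i)"
    unfolding sum_distrib_right
    using assms by (intro sum_mono mult_left_mono power_decreasing) auto
  \<comment> \<open>Either of \<open>d\<close> and \<open>N\<close> may be larger; beyond
    \<open>N\<close> the binomials vanish, so the extended sum is the full binomial
    expansion.\<close>
  also have "\<dots> \<le> (\<Sum>i=0..max d N. real (N choose i) * t ^ i)"
    using assms by (intro sum_mono2) auto
  also have "\<dots> = (\<Sum>i\<le>N. real (N choose i) * t ^ i)"
    by (rule sum.mono_neutral_right) (auto simp: binomial_eq_0)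
  also have "\<dots> = (1 + t) ^ N" using binomial_ring[of t 1 N] by (simp add: add.commute)
  also have "\<dots> \<le> exp t ^ N" using assms by (intro power_mono exp_ge_add_one_self) auto
  also have "\<dots> = exp (t * real N)" by (simp add: exp_of_nat_mult[symmetric] mult.commute)
  finally show ?thesis using assms by (simp add: field_simps)
qed

text \<open>A weak Stirling bound: the term of index \<open>n\<close> in the exponential series at
  \<open>n\<close> is at most the whole series.\<close>

lemma power_le_exp_mult_fact: "real n ^ n \<le> exp (real n) * fact n"
proof -
  have "(\<Sum>i\<in>{n}. real n ^ i /\<^sub>R fact i) \<le> (\<Sum>i. real n ^ i /\<^sub>R fact i)"
    by (intro sum_le_suminf summable_exp_generic) auto
  then show ?thesis by (simp add: exp_def field_simps)
qed

text \<open>Since \<open>2 * (n choose 2)\<close> is at most \<open>n^2\<close>, the product term is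
  at most \<open>n^4 / 2\<close>; the two linear terms sum to at most \<open>n^2\<close>, which is
  at most \<open>n^4 / 2\<close> for \<open>n >= 2\<close>.\<close>

lemma form_count_le_power4:
  assumes "2 \<le> n"
  shows "real (2 * (n choose 2) * (n choose 2) + (n choose 2) + (n choose 2)) \<le> real n ^ 4"
proof -
  have c: "2 * real (n choose 2) \<le> (real n)\<^sup>2"
  proof -
    have "2 * (n choose 2) \<le> n * (n - 1)" by (simp add: choose_two)
    also have "\<dots> \<le> n * n" by simp
    finally have "2 * (n choose 2) \<le> n * n" .
    then show ?thesis by (metis of_nat_le_iff of_nat_mult of_nat_numeral power2_eq_square)
  qed
  have "(2 * real (n choose 2))\<^sup>2 \<le> ((real n)\<^sup>2)\<^sup>2" using c by (intro power_mono) auto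
  moreover have "2 * (real n)\<^sup>2 \<le> ((real n)\<^sup>2)\<^sup>2"
  proof -
    have "2 * 2 \<le> real n * real n" using assms by (intro mult_mono) auto
    then show ?thesis unfolding power2_eq_square[of "(real n)\<^sup>2"]
      by (intro mult_right_mono) (auto simp: power2_eq_square)
  qed
  moreover have "((real n)\<^sup>2)\<^sup>2 = real n ^ 4" by (simp flip: power_mult)
  ultimately show ?thesis using c by (simp add: power2_eq_square)
qed

text \<open>The binomial sum contributes \<open>n^(6n)\<close>, and dividing by the squared
  factorial removes \<open>n^(2n)\<close> at the cost of \<open>exp (2n)\<close>.\<close>

lemma card_rSYT_square_le:
  assumes n: "2 \<le> n"
  shows "real (card (rSYT n n)) \<le> real n ^ (4 * n) * exp (4 * real n)"
proof -
  \<comment> \<open>With at most \<open>n^4\<close> forms, this \<open>t\<close> keeps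
    \<open>t * N\<close> at most \<open>n\<close>, while \<open>1 / t^(2n)\<close> is
    \<open>n^(6n)\<close>.\<close>
  define t where "t = 1 / real n ^ 3"
  define N where "N = 2 * (n choose 2) * (n choose 2) + (n choose 2) + (n choose 2)"
  have t: "0 < t" "t \<le> 1" using n by (auto simp: t_def)
  have "t * real N \<le> t * real n ^ 4"
    using form_count_le_power4[OF n] t unfolding N_def by (intro mult_left_mono) auto
  also have "\<dots> = real n" using n by (simp add: t_def field_simps eval_nat_numeral)
  \<comment> \<open>The exponent \<open>n\<close> is relaxed to \<open>2n\<close>, so that together
    with the factorial bound the total is \<open>4n\<close>.\<close>
  finally have tN: "exp (t * real N) \<le> exp (2 * real n)" by simp
  have "(\<Sum>i = 0..n + n. real (N choose i)) \<le> exp (t * real N) / t ^ (n + n)"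
    by (rule sum_binomial_le_exp[OF t])
  also have "\<dots> \<le> exp (2 * real n) / t ^ (n + n)"
    using tN t by (intro divide_right_mono) auto
  also have "\<dots> = exp (2 * real n) * real n ^ (6 * n)"
    by (simp add: t_def power_divide flip: power_mult)
  finally have S: "(\<Sum>i = 0..n + n. real (N choose i)) \<le> exp (2 * real n) * real n ^ (6 * n)" .
  have "real n ^ n * real n ^ n \<le> (exp (real n) * fact n) * (exp (real n) * fact n)"
    by (intro mult_mono power_le_exp_mult_fact) auto
  moreover have "real n ^ n * real n ^ n = real n ^ (2 * n)" by (simp add: mult_2 power_add)
  moreover have "exp (real n) * exp (real n) = exp (2 * real n)" by (simp add: mult_exp_exp)
  ultimately have F: "real n ^ (2 * n) \<le> exp (2 * real n) * (fact n * fact n)"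
    by (simp add: mult_ac)
  have "real (card (rSYT n n)) * real n ^ (2 * n)
      \<le> real (card (rSYT n n)) * (exp (2 * real n) * (fact n * fact n))"
    using F by (intro mult_left_mono) auto
  also have "\<dots> = exp (2 * real n) * (real (card (rSYT n n)) * (fact n * fact n))" by simp
  also have "\<dots> \<le> exp (2 * real n) * (\<Sum>i = 0..n + n. real (N choose i))"
    using card_rSYT_le[of n n] n unfolding N_def[symmetric] by (intro mult_left_mono) (auto simp: field_simps)
  also have "\<dots> \<le> exp (2 * real n) * (exp (2 * real n) * real n ^ (6 * n))"
    using S by (intro mult_left_mono) auto
  also have "\<dots> = real n ^ (4 * n) * exp (4 * real n) * real n ^ (2 * n)"
  proof -
    have "exp (2 * real n) * exp (2 * real n) = exp (4 * real n)" by (simp add: mult_exp_exp)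
    moreover have "real n ^ (6 * n) = real n ^ (4 * n) * real n ^ (2 * n)"
      by (simp flip: power_add)
    ultimately show ?thesis by (simp add: mult_ac)
  qed
  finally show ?thesis using n by simp
qed

text \<open>This is the error exponent: \<open>exp (4n)\<close> equals \<open>n\<close> to the power
  \<open>4n / ln n\<close>, and division by \<open>n\<close> leaves \<open>4 / ln n\<close>, which
  tends to 0.\<close>

lemma div_ln_smallo: "(\<lambda>n. 4 * real n / ln (real n)) \<in> o[at_top](\<lambda>n. real n)"
proof (rule smalloI_tendsto)
  have "filterlim (\<lambda>n::nat. ln (real n)) at_top at_top"
    by (rule filterlim_compose[OF ln_at_top filterlim_real_sequentially])
  then have "((\<lambda>n::nat. 4 / ln (real n)) \<longlongrightarrow> 0) at_top"
    by (rule real_tendsto_divide_at_top[OF tendsto_const])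
  then show "((\<lambda>n::nat. 4 * real n / ln (real n) / real n) \<longlongrightarrow> 0) at_top"
    by (rule Lim_transform_eventually) (auto intro!: eventually_mono[OF eventually_gt_at_top[of 0]])
  show "\<forall>\<^sub>F n::nat in at_top. real n \<noteq> 0"
    by (auto intro!: eventually_mono[OF eventually_gt_at_top[of 0]])
qed

theorem theorem1p2:
  "(\<forall>m n :: nat. 0 < m \<and> m \<le> n \<longrightarrow>
      real (card (rSYT m n)) \<le>
        1 / (fact m * fact n) *
        (\<Sum>i = 0..m + n.
           real ((2 * (m choose 2) * (n choose 2) + (m choose 2) + (n choose 2)) choose i))) \<and>
   (\<exists>f :: nat \<Rightarrow> real. f \<in> o[at_top](\<lambda>n. real n) \<and>
      (\<forall>\<^sub>F n in at_top. real (card (rSYT n n)) \<le> real n powr (4 * real n + f n)))"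
proof -
  have "real (card (rSYT n n)) \<le> real n powr (4 * real n + 4 * real n / ln (real n))"
    if n: "2 \<le> n" for n
  proof -
    have "real (card (rSYT n n)) \<le> real n ^ (4 * n) * exp (4 * real n)"
      by (rule card_rSYT_square_le[OF n])
    also have "\<dots> = real n powr (4 * real n) * real n powr (4 * real n / ln (real n))"
    proof -
      have "real n powr (4 * real n) = real n ^ (4 * n)"
        using n powr_realpow[of "real n" "4 * n"] by simp
      \<comment> \<open>For \<open>n >= 2\<close> the logarithm is nonzero and cancels in the
        exponent.\<close>
      moreover have "real n powr (4 * real n / ln (real n)) = exp (4 * real n)"
        using n by (simp add: powr_def)
      ultimately show ?thesis by simp
    qed
    finally show ?thesis by (simp add: powr_add)
  qed
  then have "\<forall>\<^sub>F n in at_top. real (card (rSYT n n)) \<le>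
      real n powr (4 * real n + 4 * real n / ln (real n))"
    by (rule eventually_mono[OF eventually_ge_at_top[of 2]])
  then show ?thesis using card_rSYT_le div_ln_smallo by (auto intro: less_le_trans)
qed

end
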